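(* There exists a constant $c>0$ such that for all sufficiently large $n$, $\rho^+(\ell_1^n)\ge c\sqrt n$.
   Context: Banach spaces are real. For a finite-dimensional Banach space $E$, $$\rho^+(E)=\sup\{\|z\|_{E\hat\otimes E}: z\in E\otimes E,\ \|z\|_{E\check\otimes E}\le1,\ z\ge0\},$$ where $\hat\otimes$, $\check\otimes$ denote the projective and injective tensor products and $z\ge0$ means that $z$ is in the convex hull of $\{x\otimes x:x\in E\}$. *)

theory Defs
  imports "HOL-Analysis.Analysis" "HOL-Analysis.Finite_Function_Topology"
begin

text \<open>
  A finite-dimensional Banach space is given as a finite-dimensional subspace \<open>E\<close> of some real
  normed space \<open>'a\<close>, with the norm of \<open>'a\<close>, so that spaces of varying dimension live in one type.

  The algebraic tensor product of \<open>'a\<close> with itself is realised inside the bilinear forms on its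
  dual, \<open>x \<otimes> y\<close> being the form \<open>(\<phi>, \<psi>) \<mapsto> \<phi> x * \<psi> y\<close>. Nothing is identified that
  should not be, because bounded functionals separate points.
\<close>

lift_definition tensor ::
    "'a::real_normed_vector \<Rightarrow> 'a \<Rightarrow> ('a \<Rightarrow>\<^sub>L real) \<Rightarrow>\<^sub>L ('a \<Rightarrow>\<^sub>L real) \<Rightarrow>\<^sub>L real"
    (infixr "\<otimes>\<^sub>t" 75)
  is "\<lambda>x y \<phi>. blinfun_apply \<phi> x *\<^sub>R blinfun.prod_left y"
  by (intro bounded_linear_intros)

lemma tensor_apply [simp]:
  "blinfun_apply (blinfun_apply (x \<otimes>\<^sub>t y) \<phi>) \<psi> = blinfun_apply \<phi> x * blinfun_apply \<psi> y"
  by (simp add: tensor.rep_eq blinfun.scaleR_left blinfun.prod_left.rep_eq)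

definition tensor_square ::
    "'a::real_normed_vector set \<Rightarrow> (('a \<Rightarrow>\<^sub>L real) \<Rightarrow>\<^sub>L ('a \<Rightarrow>\<^sub>L real) \<Rightarrow>\<^sub>L real) set" where
  "tensor_square E = span {x \<otimes>\<^sub>t y | x y. x \<in> E \<and> y \<in> E}"

text \<open>
  The restrictions to \<open>E\<close> of the functionals below form the closed unit ball of the dual of \<open>E\<close>:
  every functional on \<open>E\<close> extends to a bounded functional on \<open>'a\<close>. Only the values on \<open>E\<close> are
  bounded, and the value of an element of \<open>tensor_square E\<close> at a pair of functionals depends only
  on their restrictions to \<open>E\<close>.
\<close>

definition dual_ball :: "'a::real_normed_vector set \<Rightarrow> ('a \<Rightarrow>\<^sub>L real) set" where
  "dual_ball E = {\<phi>. \<forall>x\<in>E. \<bar>blinfun_apply \<phi> x\<bar> \<le> norm x}"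

definition injective_norm ::
    "'a::real_normed_vector set \<Rightarrow> (('a \<Rightarrow>\<^sub>L real) \<Rightarrow>\<^sub>L ('a \<Rightarrow>\<^sub>L real) \<Rightarrow>\<^sub>L real) \<Rightarrow> real" where
  "injective_norm E z =
     (SUP (\<phi>, \<psi>) \<in> dual_ball E \<times> dual_ball E. \<bar>blinfun_apply (blinfun_apply z \<phi>) \<psi>\<bar>)"

definition projective_norm ::
    "'a::real_normed_vector set \<Rightarrow> (('a \<Rightarrow>\<^sub>L real) \<Rightarrow>\<^sub>L ('a \<Rightarrow>\<^sub>L real) \<Rightarrow>\<^sub>L real) \<Rightarrow> real" where
  "projective_norm E z =
     Inf {\<Sum>k<m. norm (x k) * norm (y k) | (m::nat) x y.
            (\<forall>k<m. x k \<in> E \<and> y k \<in> E) \<and> z = (\<Sum>k<m. x k \<otimes>\<^sub>t y k)}"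

definition positive_tensors ::
    "'a::real_normed_vector set \<Rightarrow> (('a \<Rightarrow>\<^sub>L real) \<Rightarrow>\<^sub>L ('a \<Rightarrow>\<^sub>L real) \<Rightarrow>\<^sub>L real) set" where
  "positive_tensors E = convex hull {x \<otimes>\<^sub>t x | x. x \<in> E}"

text \<open>
  For finite-dimensional \<open>E\<close> the supremum is that of a nonempty bounded set, since any two norms on
  \<open>tensor_square E\<close> are equivalent.
\<close>

definition rho_plus :: "'a::real_normed_vector set \<Rightarrow> real" where
  "rho_plus E = Sup {projective_norm E z | z.
     z \<in> tensor_square E \<and> injective_norm E z \<le> 1 \<and> z \<in> positive_tensors E}"

text \<open>
  The library norm on finitely supported functions is the sum of the absolute values, so the
  functions supported on the first \<open>n\<close> naturals form the \<open>n\<close>-dimensional \<open>\<ell>\<^sub>1\<close> space.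
\<close>

definition l1_space :: "nat \<Rightarrow> (nat \<Rightarrow>\<^sub>0 real) set" where
  "l1_space n = {x. Poly_Mapping.keys x \<subseteq> {..<n}}"

lemma norm_l1_space:
  assumes "x \<in> l1_space n"
  shows "norm x = (\<Sum>i<n. \<bar>Poly_Mapping.lookup x i\<bar>)"
  using assms
  by (auto simp: l1_space_def norm_poly_mapping_def dist_poly_mapping_def in_keys_iff
      intro!: sum.mono_neutral_left)

lemma lookup_scaleR:
  "Poly_Mapping.lookup (r *\<^sub>R x) i = r *\<^sub>R Poly_Mapping.lookup x i"
proof -
  have "finite {i. r *\<^sub>R Poly_Mapping.lookup x i \<noteq> 0}"
    by (rule finite_subset[OF _ finite_lookup[of x]]) auto
  then show ?thesis
    by (simp add: scaleR_poly_mapping_def)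
qed

lemma l1_space_eq_span: "l1_space n = span ((\<lambda>i. Poly_Mapping.single i 1) ` {..<n})"
proof
  have lookup_sum: "Poly_Mapping.lookup (\<Sum>i\<in>I. f i) j = (\<Sum>i\<in>I. Poly_Mapping.lookup (f i) j)"
    for I :: "nat set" and f :: "nat \<Rightarrow> nat \<Rightarrow>\<^sub>0 real" and j
    by (induction I rule: infinite_finite_induct) (auto simp: lookup_add)
  show "l1_space n \<subseteq> span ((\<lambda>i. Poly_Mapping.single i 1) ` {..<n})"
  proof
    fix x assume x: "x \<in> l1_space n"
    have "x = (\<Sum>i<n. Poly_Mapping.lookup x i *\<^sub>R Poly_Mapping.single i 1)"
    proof (rule poly_mapping_eqI)
      fix j
      have "(\<Sum>i<n. Poly_Mapping.lookup (Poly_Mapping.lookup x i *\<^sub>R Poly_Mapping.single i 1) j)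
          = (\<Sum>i<n. if i = j then Poly_Mapping.lookup x i else 0)"
        by (intro sum.cong) (auto simp: lookup_scaleR lookup_single when_def)
      also have "\<dots> = Poly_Mapping.lookup x j"
        using x by (auto simp: l1_space_def in_keys_iff)
      finally show "Poly_Mapping.lookup x j = Poly_Mapping.lookup
          (\<Sum>i<n. Poly_Mapping.lookup x i *\<^sub>R Poly_Mapping.single i 1) j"
        by (simp add: lookup_sum)
    qed
    moreover have "\<dots> \<in> span ((\<lambda>i. Poly_Mapping.single i 1) ` {..<n})"
      by (intro span_sum span_scale span_base) auto
    ultimately show "x \<in> span ((\<lambda>i. Poly_Mapping.single i 1) ` {..<n})"
      by metis
  qed
  have "subspace (l1_space n)"
    unfolding subspace_def l1_space_def subset_iff in_keys_iff
    by (auto simp: lookup_add lookup_scaleR) (metis add.right_neutral)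
  then show "span ((\<lambda>i. Poly_Mapping.single i 1) ` {..<n}) \<subseteq> l1_space n"
    by (intro span_minimal) (auto simp: l1_space_def)
qed

end

theory Submission
  imports Defs
begin

text \<open>
  In the unit vector basis a tensor \<open>z\<close> over \<open>\<ell>\<^sub>1\<close> is a matrix. Its projective norm is the sum of
  the absolute values of the entries, and its injective norm is the largest value of the
  bilinear form on vectors with entries in \<open>[-1, 1]\<close>. A positive \<open>z\<close> is a positive
  semidefinite matrix. So the task is to find a positive semidefinite matrix which is small as a
  bilinear form but has a large total mass of entries.

  An orthogonal projection \<open>P\<close> of \<open>\<real>\<^sup>N\<close> does this. It is a contraction for the Euclidean norm, and
  a vector with entries in \<open>[-1, 1]\<close> has Euclidean norm at most \<open>\<surd>N\<close>, so \<open>P / N\<close> has injective norm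
  at most 1. Since \<open>P = P\<^sup>T P\<close>, it is the sum of the squares \<open>y \<otimes> y\<close> of its rows, hence positive.
  This gives \<open>\<rho>\<^sup>+ \<ge> (\<Sum>i j. \<bar>P i j\<bar>) / N\<close> (lemma \<open>rho_plus_l1_ge_projection\<close>).

  The mass is of the largest possible order \<open>N \<surd>N\<close> when the entries all have size about
  \<open>1 / \<surd>N\<close>. If \<open>H\<close> is a symmetric Hadamard matrix of order \<open>N\<close>, then \<open>H / \<surd>N\<close> is a symmetric
  involution, and \<open>P = (1 + H / \<surd>N) / 2\<close> is the projection onto its fixed space, with this mass.
  Sylvester's matrices exist for all \<open>N = 2 ^ m\<close>. For other \<open>n\<close> the
  largest power of two below \<open>n\<close> is used: it exceeds \<open>n / 2\<close>, so only a constant is lost.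
\<close>

section \<open>Coordinates on \<open>\<ell>\<^sub>1\<close>\<close>

abbreviation unit_vec :: "nat \<Rightarrow> nat \<Rightarrow>\<^sub>0 real" where
  "unit_vec i \<equiv> Poly_Mapping.single i 1"

lemma abs_lookup_le_norm: "\<bar>Poly_Mapping.lookup x i\<bar> \<le> norm (x :: nat \<Rightarrow>\<^sub>0 real)"
proof -
  obtain n where "Poly_Mapping.keys x \<subseteq> {..<n}"
    using finite_nat_iff_bounded finite_keys by blast
  then have "x \<in> l1_space (max n (Suc i))"
    by (auto simp: l1_space_def)
  then have "norm x = (\<Sum>j<max n (Suc i). \<bar>Poly_Mapping.lookup x j\<bar>)"
    by (rule norm_l1_space)
  moreover have "\<bar>Poly_Mapping.lookup x i\<bar> \<le> (\<Sum>j<max n (Suc i). \<bar>Poly_Mapping.lookup x j\<bar>)"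
    by (rule member_le_sum) auto
  ultimately show ?thesis
    by simp
qed

lift_definition coord :: "nat \<Rightarrow> (nat \<Rightarrow>\<^sub>0 real) \<Rightarrow>\<^sub>L real"
  is "\<lambda>i x. Poly_Mapping.lookup x i"
  by (rule bounded_linear_intro[where K = 1])
    (auto simp: lookup_add lookup_scaleR abs_lookup_le_norm)

declare coord.rep_eq [simp]

lemma coord_in_dual_ball: "coord i \<in> dual_ball E"
  by (simp add: dual_ball_def abs_lookup_le_norm)

lemma subspace_l1_space: "subspace (l1_space n)"
  by (simp add: l1_space_eq_span)

lemma unit_vec_in_l1_space: "i < n \<Longrightarrow> unit_vec i \<in> l1_space n"
  by (simp add: l1_space_def)

lemma norm_unit_vec: "norm (unit_vec i) = 1"
  using norm_l1_space[OF unit_vec_in_l1_space[OF lessI, of i]]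
  by (simp add: lookup_single when_def if_distrib cong: if_cong)

lemma dual_ball_unit_vec:
  assumes "\<phi> \<in> dual_ball (l1_space n)" "i < n"
  shows "\<bar>blinfun_apply \<phi> (unit_vec i)\<bar> \<le> 1"
proof -
  have "\<bar>blinfun_apply \<phi> (unit_vec i)\<bar> \<le> norm (unit_vec i)"
    using assms(1) unit_vec_in_l1_space[OF assms(2)] unfolding dual_ball_def by blast
  then show ?thesis
    by (simp add: norm_unit_vec)
qed

lemma l1_space_expansion:
  assumes "x \<in> l1_space n"
  shows "x = (\<Sum>i<n. Poly_Mapping.lookup x i *\<^sub>R unit_vec i)"
proof -
  have *: "Poly_Mapping.lookup (\<Sum>i\<in>I. Poly_Mapping.lookup x i *\<^sub>R unit_vec i) j =
     (\<Sum>i\<in>I. if i = j then Poly_Mapping.lookup x i else 0)" for I j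
    by (induction I rule: infinite_finite_induct)
      (auto simp: lookup_add lookup_scaleR lookup_single when_def)
  show ?thesis
    using assms by (intro poly_mapping_eqI) (auto simp: * l1_space_def in_keys_iff)
qed

lemma functional_expansion:
  assumes "x \<in> l1_space n"
  shows "blinfun_apply \<phi> x = (\<Sum>i<n. Poly_Mapping.lookup x i * blinfun_apply \<phi> (unit_vec i))"
proof -
  have "blinfun_apply \<phi> x = blinfun_apply \<phi> (\<Sum>i<n. Poly_Mapping.lookup x i *\<^sub>R unit_vec i)"
    using l1_space_expansion[OF assms] by simp
  then show ?thesis
    by (simp add: blinfun.sum_right blinfun.scaleR_right)
qed

section \<open>Tensors over \<open>\<ell>\<^sub>1\<close> as matrices\<close>

definition entry :: "(((nat \<Rightarrow>\<^sub>0 real) \<Rightarrow>\<^sub>L real) \<Rightarrow>\<^sub>L ((nat \<Rightarrow>\<^sub>0 real) \<Rightarrow>\<^sub>L real) \<Rightarrow>\<^sub>L real) \<Rightarrow> nat \<Rightarrow> nat \<Rightarrow> real" where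
  "entry z i j = blinfun_apply (blinfun_apply z (coord i)) (coord j)"

lemma entry_tensor: "entry (x \<otimes>\<^sub>t y) i j = Poly_Mapping.lookup x i * Poly_Mapping.lookup y j"
  by (simp add: entry_def)

lemma entry_sum: "entry (\<Sum>k\<in>I. z k) i j = (\<Sum>k\<in>I. entry (z k) i j)"
  by (simp add: entry_def blinfun.sum_left)

lemma entry_scaleR: "entry (c *\<^sub>R z) i j = c * entry z i j"
  by (simp add: entry_def blinfun.scaleR_left)

lemma entry_add: "entry (z + w) i j = entry z i j + entry w i j"
  by (simp add: entry_def blinfun.add_left)

text \<open>
  Both sides are linear in \<open>z\<close>, so it suffices to compare them on elementary tensors, where they
  are the product of two functionals expanded in coordinates.
\<close>
lemma tensor_square_apply:
  assumes "z \<in> tensor_square (l1_space n)"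
  shows "blinfun_apply (blinfun_apply z \<phi>) \<psi> =
    (\<Sum>i<n. \<Sum>j<n. entry z i j * (blinfun_apply \<phi> (unit_vec i) * blinfun_apply \<psi> (unit_vec j)))"
  using assms unfolding tensor_square_def
proof (induction rule: span_induct_alt)
  case base
  then show ?case by (simp add: entry_def)
next
  case (step c t z)
  then obtain x y where t: "t = x \<otimes>\<^sub>t y" and xy: "x \<in> l1_space n" "y \<in> l1_space n" by auto
  have "blinfun_apply \<phi> x * blinfun_apply \<psi> y = (\<Sum>i<n. \<Sum>j<n.
      entry t i j * (blinfun_apply \<phi> (unit_vec i) * blinfun_apply \<psi> (unit_vec j)))"
    by (simp add: t entry_tensor functional_expansion[OF xy(1)] functional_expansion[OF xy(2)]
        sum_product mult_ac)
  then show ?case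
    by (simp add: t entry_add entry_scaleR blinfun.add_left blinfun.scaleR_left step.IH
        distrib_right sum.distrib sum_distrib_left mult.assoc)
qed

lemma tensor_square_expansion:
  assumes "z \<in> tensor_square (l1_space n)"
  shows "z = (\<Sum>(i, j)\<in>{..<n} \<times> {..<n}. (entry z i j *\<^sub>R unit_vec i) \<otimes>\<^sub>t unit_vec j)"
  by (intro blinfun_eqI)
    (simp add: tensor_square_apply[OF assms] blinfun.sum_left blinfun.scaleR_right
      sum.cartesian_product case_prod_unfold mult.assoc)

section \<open>The norms of a tensor in terms of its matrix\<close>

definition representation_costs ::
    "'a::real_normed_vector set \<Rightarrow> (('a \<Rightarrow>\<^sub>L real) \<Rightarrow>\<^sub>L ('a \<Rightarrow>\<^sub>L real) \<Rightarrow>\<^sub>L real) \<Rightarrow> real set" where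
  "representation_costs E z = {\<Sum>k<m. norm (x k) * norm (y k) | (m::nat) x y.
     (\<forall>k<m. x k \<in> E \<and> y k \<in> E) \<and> z = (\<Sum>k<m. x k \<otimes>\<^sub>t y k)}"

lemma projective_norm_eq_Inf: "projective_norm E z = Inf (representation_costs E z)"
  by (simp add: projective_norm_def representation_costs_def)

lemma bdd_below_representation_costs: "bdd_below (representation_costs E z)"
  by (rule bdd_belowI[of _ 0]) (auto simp: representation_costs_def intro!: sum_nonneg)

text \<open>
  The definition of the projective norm numbers the terms of a representation; this admits any
  finite index set, such as the pairs of indices of a matrix.
\<close>
lemma representation_costsI:
  assumes "finite I" and xy: "\<And>k. k \<in> I \<Longrightarrow> x k \<in> E \<and> y k \<in> E"
    and z: "z = (\<Sum>k\<in>I. x k \<otimes>\<^sub>t y k)"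
  shows "(\<Sum>k\<in>I. norm (x k) * norm (y k)) \<in> representation_costs E z"
proof -
  obtain h where h: "bij_betw h {..<card I} I"
    using ex_bij_betw_nat_finite[OF assms(1)] by (auto simp: atLeast0LessThan)
  have reindex: "(\<Sum>k\<in>I. f k) = (\<Sum>k<card I. f (h k))" for f :: "_ \<Rightarrow> 'c::comm_monoid_add"
    using sum.reindex_bij_betw[OF h] by metis
  show ?thesis
    unfolding representation_costs_def reindex z using xy bij_betwE[OF h]
    by (intro CollectI exI[of _ "card I"] exI[of _ "x \<circ> h"] exI[of _ "y \<circ> h"]) auto
qed

text \<open>
  The representation by matrix units attains the sum. No other one is cheaper: the functional
  \<open>\<Sum>i j. \<bar>entry z i j\<bar>\<close> is subadditive and equals \<open>norm x * norm y\<close> on \<open>x \<otimes> y\<close>.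
\<close>
lemma projective_norm_l1:
  assumes z: "z \<in> tensor_square (l1_space n)"
  shows "projective_norm (l1_space n) z = (\<Sum>i<n. \<Sum>j<n. \<bar>entry z i j\<bar>)"
proof (rule antisym)
  let ?C = "representation_costs (l1_space n) z"
  have "(\<Sum>p\<in>{..<n} \<times> {..<n}.
     norm (entry z (fst p) (snd p) *\<^sub>R unit_vec (fst p)) * norm (unit_vec (snd p))) \<in> ?C"
    using tensor_square_expansion[OF z]
    by (intro representation_costsI)
      (auto simp: case_prod_unfold unit_vec_in_l1_space intro!: subspace_scale[OF subspace_l1_space])
  then have attained: "(\<Sum>i<n. \<Sum>j<n. \<bar>entry z i j\<bar>) \<in> ?C"
    by (simp add: norm_unit_vec sum.cartesian_product case_prod_unfold)
  then show "projective_norm (l1_space n) z \<le> (\<Sum>i<n. \<Sum>j<n. \<bar>entry z i j\<bar>)"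
    unfolding projective_norm_eq_Inf by (rule cInf_lower[OF _ bdd_below_representation_costs])
  have lower: "(\<Sum>i<n. \<Sum>j<n. \<bar>entry z i j\<bar>) \<le> (\<Sum>k<m. norm (x k) * norm (y k))"
    if xy: "\<forall>k<m. x k \<in> l1_space n \<and> y k \<in> l1_space n" and z': "z = (\<Sum>k<m. x k \<otimes>\<^sub>t y k)"
    for m :: nat and x y
  proof -
    have "(\<Sum>i<n. \<Sum>j<n. \<bar>entry z i j\<bar>) \<le> (\<Sum>i<n. \<Sum>j<n. \<Sum>k<m.
        \<bar>Poly_Mapping.lookup (x k) i\<bar> * \<bar>Poly_Mapping.lookup (y k) j\<bar>)"
      unfolding z' entry_sum entry_tensor abs_mult[symmetric] by (intro sum_mono sum_abs)
    also have "\<dots> = (\<Sum>i<n. \<Sum>k<m. \<Sum>j<n.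
        \<bar>Poly_Mapping.lookup (x k) i\<bar> * \<bar>Poly_Mapping.lookup (y k) j\<bar>)"
      by (intro sum.cong refl sum.swap)
    also have "\<dots> = (\<Sum>k<m. \<Sum>i<n. \<Sum>j<n.
        \<bar>Poly_Mapping.lookup (x k) i\<bar> * \<bar>Poly_Mapping.lookup (y k) j\<bar>)"
      by (rule sum.swap)
    also have "\<dots> = (\<Sum>k<m. norm (x k) * norm (y k))"
      using xy by (intro sum.cong refl) (simp add: norm_l1_space[of _ n] sum_product)
    finally show ?thesis .
  qed
  show "(\<Sum>i<n. \<Sum>j<n. \<bar>entry z i j\<bar>) \<le> projective_norm (l1_space n) z"
    unfolding projective_norm_eq_Inf
  proof (rule cInf_greatest)
    show "?C \<noteq> {}"
      using attained by blast
    show "(\<Sum>i<n. \<Sum>j<n. \<bar>entry z i j\<bar>) \<le> c" if "c \<in> ?C" for c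
      using that lower unfolding representation_costs_def by blast
  qed
qed

text \<open>
  An entry is the value at a pair of coordinate functionals, which lie in the dual ball. The
  content is that the supremum defining the injective norm is finite, and so bounds its members.
\<close>
lemma abs_entry_le_injective_norm:
  assumes z: "z \<in> tensor_square (l1_space n)"
  shows "\<bar>entry z i j\<bar> \<le> injective_norm (l1_space n) z"
proof -
  let ?D = "dual_ball (l1_space n)"
  have "\<bar>blinfun_apply (blinfun_apply z \<phi>) \<psi>\<bar> \<le> (\<Sum>i<n. \<Sum>j<n. \<bar>entry z i j\<bar>)"
    if "\<phi> \<in> ?D" "\<psi> \<in> ?D" for \<phi> \<psi>
    unfolding tensor_square_apply[OF z]
    by (intro order.trans[OF sum_abs] sum_mono)
      (auto simp: abs_mult intro!: mult_left_le mult_le_one dual_ball_unit_vec that)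
  then have "bdd_above ((\<lambda>(\<phi>, \<psi>). \<bar>blinfun_apply (blinfun_apply z \<phi>) \<psi>\<bar>) ` (?D \<times> ?D))"
    by (intro bdd_aboveI2[where M = "\<Sum>i<n. \<Sum>j<n. \<bar>entry z i j\<bar>"]) auto
  from cSUP_upper[OF _ this, of "(coord i, coord j)"] show ?thesis
    by (simp add: injective_norm_def entry_def coord_in_dual_ball)
qed

text \<open>
  The supremum \<open>\<rho>\<^sup>+\<close> is finite: injective norm at most 1 bounds each of the \<open>n\<^sup>2\<close> entries by 1, and
  hence the projective norm by \<open>n\<^sup>2\<close>.
\<close>
lemma projective_norm_le_rho_plus_l1:
  assumes "z \<in> tensor_square (l1_space n)" "injective_norm (l1_space n) z \<le> 1"
    "z \<in> positive_tensors (l1_space n)"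
  shows "projective_norm (l1_space n) z \<le> rho_plus (l1_space n)"
  unfolding rho_plus_def
proof (rule cSup_upper)
  have "projective_norm (l1_space n) w \<le> (\<Sum>i<n. \<Sum>j<n. 1)"
    if "w \<in> tensor_square (l1_space n)" "injective_norm (l1_space n) w \<le> 1" for w
    unfolding projective_norm_l1[OF that(1)]
    by (intro sum_mono order.trans[OF abs_entry_le_injective_norm that(2)] that)
  then show "bdd_above {projective_norm (l1_space n) z |z. z \<in> tensor_square (l1_space n) \<and>
      injective_norm (l1_space n) z \<le> 1 \<and> z \<in> positive_tensors (l1_space n)}"
    by (intro bdd_aboveI[where M = "\<Sum>i<n. \<Sum>j<n. 1"]) auto
qed (use assms in auto)

section \<open>Lower bounds from orthogonal projections\<close>

text \<open>
  The hypothesis is \<open>P\<^sup>T P = P\<close>, which says that \<open>P\<close> is symmetric and idempotent. It gives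
  \<open>\<langle>P s, P s\<rangle> = \<langle>s, P s\<rangle>\<close>, and expanding \<open>\<langle>s - P s, s - P s\<rangle> \<ge> 0\<close> then bounds the norm of \<open>P s\<close>.
\<close>
lemma orthogonal_projection_contracts:
  fixes P :: "'i \<Rightarrow> 'i \<Rightarrow> real"
  assumes gram: "\<And>i j. i \<in> I \<Longrightarrow> j \<in> I \<Longrightarrow> (\<Sum>k\<in>I. P k i * P k j) = P i j"
  shows "(\<Sum>k\<in>I. (\<Sum>i\<in>I. P k i * s i)\<^sup>2) \<le> (\<Sum>k\<in>I. (s k)\<^sup>2)"
proof -
  let ?Ps = "\<lambda>k. \<Sum>i\<in>I. P k i * s i"
  have "(\<Sum>k\<in>I. (?Ps k)\<^sup>2) = (\<Sum>k\<in>I. \<Sum>i\<in>I. \<Sum>j\<in>I. s i * s j * (P k i * P k j))"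
    by (simp add: power2_eq_square sum_product mult_ac)
  also have "\<dots> = (\<Sum>i\<in>I. \<Sum>k\<in>I. \<Sum>j\<in>I. s i * s j * (P k i * P k j))"
    by (rule sum.swap)
  also have "\<dots> = (\<Sum>i\<in>I. \<Sum>j\<in>I. \<Sum>k\<in>I. s i * s j * (P k i * P k j))"
    by (intro sum.cong refl sum.swap)
  also have "\<dots> = (\<Sum>i\<in>I. \<Sum>j\<in>I. s i * s j * P i j)"
    by (intro sum.cong refl) (simp add: gram flip: sum_distrib_left)
  also have "\<dots> = (\<Sum>i\<in>I. s i * ?Ps i)"
    by (simp add: sum_distrib_left mult_ac)
  finally have eq: "(\<Sum>k\<in>I. (?Ps k)\<^sup>2) = (\<Sum>k\<in>I. s k * ?Ps k)" .
  have "0 \<le> (\<Sum>k\<in>I. (s k - ?Ps k)\<^sup>2)"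
    by (intro sum_nonneg) simp
  also have "\<dots> = (\<Sum>k\<in>I. (s k)\<^sup>2) - 2 * (\<Sum>k\<in>I. s k * ?Ps k) + (\<Sum>k\<in>I. (?Ps k)\<^sup>2)"
    by (simp add: power2_diff sum.distrib sum_subtractf sum_distrib_left mult.assoc)
  finally show ?thesis
    using eq by simp
qed

text \<open>
  The witness is \<open>P / N\<close>, written as the average of \<open>y k \<otimes> y k\<close> over the rows \<open>y k\<close> of \<open>P\<close>: this
  makes it a convex combination of squares, and by \<open>P\<^sup>T P = P\<close> its matrix is \<open>P / N\<close>.
\<close>
lemma rho_plus_l1_ge_projection:
  fixes P :: "nat \<Rightarrow> nat \<Rightarrow> real"
  assumes N: "0 < N" "N \<le> n"
    and gram: "\<And>i j. i < N \<Longrightarrow> j < N \<Longrightarrow> (\<Sum>k<N. P k i * P k j) = P i j"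
  shows "(\<Sum>i<N. \<Sum>j<N. \<bar>P i j\<bar>) / real N \<le> rho_plus (l1_space n)"
proof -
  define y where "y k = (\<Sum>i<N. P k i *\<^sub>R unit_vec i)" for k
  define z where "z = (\<Sum>k<N. (1 / real N) *\<^sub>R (y k \<otimes>\<^sub>t y k))"
  have y: "y k \<in> l1_space n" for k
    unfolding y_def using N
    by (intro subspace_sum[OF subspace_l1_space] subspace_scale[OF subspace_l1_space]
        unit_vec_in_l1_space) auto
  have \<phi>y: "blinfun_apply \<phi> (y k) = (\<Sum>i<N. P k i * blinfun_apply \<phi> (unit_vec i))" for \<phi> k
    by (simp add: y_def blinfun.sum_right blinfun.scaleR_right)
  have lookup_y: "Poly_Mapping.lookup (y k) i = P k i" if "i < N" for k i
    using \<phi>y[of "coord i" k] that by (simp add: lookup_single when_def if_distrib cong: if_cong)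
  have square: "z \<in> tensor_square (l1_space n)"
    unfolding z_def tensor_square_def using y by (intro span_sum span_scale span_base) auto
  have pos: "z \<in> positive_tensors (l1_space n)"
    unfolding z_def positive_tensors_def using y N
    by (intro convex_sum convex_convex_hull hull_inc) auto
  have "injective_norm (l1_space n) z \<le> 1"
    unfolding injective_norm_def
  proof (rule cSUP_least)
    show "dual_ball (l1_space n) \<times> dual_ball (l1_space n) \<noteq> {}"
      using coord_in_dual_ball by blast
  next
    \<comment> \<open>The values of \<open>\<theta>\<close> on the rows are the entries of \<open>P s\<close>, where \<open>s\<close> consists of the values
      of \<open>\<theta>\<close> on the unit vectors.\<close>
    have sq: "(\<Sum>k<N. (blinfun_apply \<theta> (y k))\<^sup>2) \<le> real N" if "\<theta> \<in> dual_ball (l1_space n)" for \<theta>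
    proof -
      have "(\<Sum>k<N. (blinfun_apply \<theta> (y k))\<^sup>2) \<le> (\<Sum>k<N. (blinfun_apply \<theta> (unit_vec k))\<^sup>2)"
        unfolding \<phi>y by (rule orthogonal_projection_contracts) (use gram in auto)
      also have "\<dots> \<le> (\<Sum>k<N. 1)"
      proof (rule sum_mono)
        fix k assume "k \<in> {..<N}"
        then have "\<bar>blinfun_apply \<theta> (unit_vec k)\<bar> \<le> 1"
          using N by (intro dual_ball_unit_vec[OF that]) auto
        then show "(blinfun_apply \<theta> (unit_vec k))\<^sup>2 \<le> 1"
          by (simp add: abs_square_le_1)
      qed
      finally show ?thesis by simp
    qed
    fix p assume "p \<in> dual_ball (l1_space n) \<times> dual_ball (l1_space n)"
    then obtain \<phi> \<psi> where p: "p = (\<phi>, \<psi>)"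
      and \<phi>: "\<phi> \<in> dual_ball (l1_space n)" and \<psi>: "\<psi> \<in> dual_ball (l1_space n)" by auto
    have "\<bar>\<Sum>k<N. blinfun_apply \<phi> (y k) * blinfun_apply \<psi> (y k)\<bar> \<le>
        (\<Sum>k<N. ((blinfun_apply \<phi> (y k))\<^sup>2 + (blinfun_apply \<psi> (y k))\<^sup>2) / 2)"
    proof (intro order.trans[OF sum_abs] sum_mono)
      show "\<bar>a * b\<bar> \<le> (a\<^sup>2 + b\<^sup>2) / 2" for a b :: real
        using zero_le_power2[of "\<bar>a\<bar> - \<bar>b\<bar>"] by (simp add: power2_diff abs_mult)
    qed
    also have "\<dots> \<le> real N"
      using sq[OF \<phi>] sq[OF \<psi>] by (simp add: sum.distrib flip: sum_divide_distrib)
    finally show "(case p of (\<phi>, \<psi>) \<Rightarrow> \<bar>blinfun_apply (blinfun_apply z \<phi>) \<psi>\<bar>) \<le> 1"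
      using N by (simp add: p z_def blinfun.sum_left blinfun.scaleR_left flip: sum_divide_distrib)
  qed
  from projective_norm_le_rho_plus_l1[OF square this pos]
  have "(\<Sum>i<n. \<Sum>j<n. \<bar>entry z i j\<bar>) \<le> rho_plus (l1_space n)"
    by (simp add: projective_norm_l1[OF square])
  moreover have "(\<Sum>i<N. \<Sum>j<N. \<bar>entry z i j\<bar>) \<le> (\<Sum>i<n. \<Sum>j<n. \<bar>entry z i j\<bar>)"
    unfolding sum.cartesian_product using N by (intro sum_mono2) auto
  moreover have "(\<Sum>i<N. \<Sum>j<N. \<bar>entry z i j\<bar>) = (\<Sum>i<N. \<Sum>j<N. \<bar>P i j\<bar> / real N)"
    by (intro sum.cong refl)
      (simp add: z_def entry_sum entry_scaleR entry_tensor lookup_y gram flip: sum_divide_distrib)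
  ultimately show ?thesis
    by (simp flip: sum_divide_distrib)
qed

section \<open>Sylvester's Hadamard matrices\<close>

text \<open>
  The entry is \<open>-1\<close> to the number of binary positions where both \<open>i\<close> and \<open>j\<close> have the digit 1.
  Stripping the lowest digit, rather than the highest, splits a sum over the index into even and
  odd terms, without case distinctions on ranges.
\<close>
fun sylvester :: "nat \<Rightarrow> nat \<Rightarrow> nat \<Rightarrow> real" where
  "sylvester 0 i j = 1"
| "sylvester (Suc m) i j =
    (if odd i \<and> odd j then -1 else 1) * sylvester m (i div 2) (j div 2)"

lemma sylvester_commute: "sylvester m i j = sylvester m j i"
  by (induction m arbitrary: i j) auto

lemma abs_sylvester: "\<bar>sylvester m i j\<bar> = 1"
  by (induction m arbitrary: i j) (auto simp: abs_mult)

lemma sum_lessThan_double: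
  "(\<Sum>k<2 * n. f k) = (\<Sum>k<n. f (2 * k) + f (Suc (2 * k)))" for f :: "nat \<Rightarrow> 'a::comm_monoid_add"
  by (induction n) (auto simp: add.assoc)

text \<open>
  Rows \<open>2 * k\<close> and \<open>2 * k + 1\<close> contribute the product for row \<open>k\<close> one step lower, first with sign
  \<open>1\<close>, then with sign \<open>?e\<close>. The two cancel if the lowest digits of \<open>i\<close> and \<open>j\<close> differ;
  otherwise they add up and the remaining digits decide.
\<close>
lemma sylvester_orthogonal:
  assumes "i < 2 ^ m" "j < 2 ^ m"
  shows "(\<Sum>k<2 ^ m. sylvester m k i * sylvester m k j) = (if i = j then 2 ^ m else 0)"
  using assms
proof (induction m arbitrary: i j)
  case 0
  then show ?case by simp
next
  case (Suc m)
  let ?e = "if odd i = odd j then 1 else - 1 :: real"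
  have "(\<Sum>k<2 ^ Suc m. sylvester (Suc m) k i * sylvester (Suc m) k j) =
      (\<Sum>k<2 ^ m. (1 + ?e) * (sylvester m k (i div 2) * sylvester m k (j div 2)))"
    unfolding power_Suc sum_lessThan_double by (intro sum.cong refl) auto
  also have "\<dots> = (1 + ?e) * (if i div 2 = j div 2 then 2 ^ m else 0)"
    unfolding sum_distrib_left[symmetric] using Suc.prems by (subst Suc.IH) auto
  also have "\<dots> = (if i = j then 2 ^ Suc m else 0)"
  proof -
    have "i = j \<longleftrightarrow> odd i = odd j \<and> i div 2 = j div 2"
      by presburger
    then show ?thesis by auto
  qed
  finally show ?case .
qed

section \<open>The lower bound of order \<open>\<surd>n\<close>\<close>

text \<open>
  For \<open>P = (1 + H / \<surd>N) / 2\<close> every entry has absolute value at least \<open>1 / (2 \<surd>N)\<close>, except that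
  on the diagonal the unit matrix may cancel against \<open>H\<close>. Subtracting \<open>1 / 2\<close> for each
  diagonal entry accounts for that and costs only \<open>N / 2\<close> in total.
\<close>
lemma rho_plus_l1_ge_dyadic:
  assumes "2 ^ m \<le> n"
  shows "(sqrt (2 ^ m) - 1) / 2 \<le> rho_plus (l1_space n)"
proof -
  define N :: nat where "N = 2 ^ m"
  define H where "H = sylvester m"
  define r where "r = sqrt (real N)"
  define P where "P i j = ((if i = j then 1 else 0) + H i j / r) / 2" for i j
  have r: "r > 0" "r * r = real N"
    by (auto simp: r_def N_def)
  \<comment> \<open>\<open>P\<^sup>T P = (1 + H / r + H\<^sup>T / r + H\<^sup>T H / r\<^sup>2) / 4\<close>, where \<open>H\<^sup>T = H\<close> and \<open>H\<^sup>T H = r\<^sup>2\<close>.\<close>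
  have gram: "(\<Sum>k<N. P k i * P k j) = P i j" if "i < N" "j < N" for i j
  proof -
    have "(\<Sum>k<N. P k i * P k j) = (\<Sum>k<N. (if k = i then (if i = j then 1 else 0) else 0) / 4
        + (if k = i then H k j else 0) / (4 * r) + (if k = j then H k i else 0) / (4 * r)
        + H k i * H k j / (4 * (r * r)))"
      using r(1) by (intro sum.cong refl) (auto simp: P_def field_simps)
    also have "\<dots> = (if i = j then 1 else 0) / 4 + H i j / (4 * r) + H j i / (4 * r)
        + (\<Sum>k<N. H k i * H k j) / (4 * (r * r))"
      using that by (simp add: sum.distrib flip: sum_divide_distrib)
    also have "\<dots> = P i j"
      using that sylvester_orthogonal[of i m j] r sylvester_commute[of m i j]
      by (auto simp: P_def H_def N_def field_simps)
    finally show ?thesis .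
  qed
  have "real N * (r - 1) / 2 = (\<Sum>i<N. \<Sum>j<N. (1 / r - (if i = j then 1 else 0)) / 2)"
  proof -
    have "real N / r = r"
      using r by (simp add: field_simps)
    then have "(\<Sum>j<N. (1 / r - (if i = j then 1 else 0)) / 2) = (r - 1) / 2" if "i < N" for i
      using that by (simp add: sum_subtractf flip: sum_divide_distrib)
    then have "(\<Sum>i<N. \<Sum>j<N. (1 / r - (if i = j then 1 else 0)) / 2) = (\<Sum>i<N. (r - 1) / 2)"
      by (intro sum.cong) auto
    then show ?thesis
      by simp
  qed
  also have "\<dots> \<le> (\<Sum>i<N. \<Sum>j<N. \<bar>P i j\<bar>)"
  proof (intro sum_mono)
    fix i j
    have "\<bar>H i j / r\<bar> = 1 / r"
      using r by (simp add: H_def abs_sylvester)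
    then have "1 / r - d \<le> \<bar>d + H i j / r\<bar>" if "d \<ge> 0" for d
      using that by linarith
    from this[of 0] this[of 1]
    have "1 / r - (if i = j then 1 else 0) \<le> \<bar>(if i = j then 1 else 0) + H i j / r\<bar>"
      by (cases "i = j") auto
    then show "(1 / r - (if i = j then 1 else 0)) / 2 \<le> \<bar>P i j\<bar>"
      unfolding P_def abs_divide abs_numeral by (rule divide_right_mono) simp
  qed
  finally have "(r - 1) / 2 \<le> (\<Sum>i<N. \<Sum>j<N. \<bar>P i j\<bar>) / real N"
    by (simp add: N_def field_simps)
  also have "\<dots> \<le> rho_plus (l1_space n)"
    using assms by (intro rho_plus_l1_ge_projection gram) (auto simp: N_def)
  finally show ?thesis
    by (simp add: r_def N_def)
qed

text \<open>
  With \<open>2 ^ m > n / 2 \<ge> 4 n / 9\<close> the dyadic bound is at least \<open>\<surd>n / 3 - 1 / 2\<close>, and this is at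
  least \<open>\<surd>n / 4\<close> as soon as \<open>\<surd>n \<ge> 6\<close>.
\<close>
theorem theorem5p9:
  shows "\<exists>c::real. c > 0 \<and> (\<forall>\<^sub>F n in sequentially. rho_plus (l1_space n) \<ge> c * sqrt (real n))"
proof (intro exI[of _ "1/4"] conjI)
  show "\<forall>\<^sub>F n in sequentially. rho_plus (l1_space n) \<ge> 1/4 * sqrt (real n)"
    using eventually_ge_at_top[of 36]
  proof eventually_elim
    case (elim n)
    then obtain m where m: "2 ^ m \<le> n" "n < 2 ^ (m + 1)"
      using ex_power_ivl1[of 2 n] by auto
    have "6 \<le> sqrt (real n)"
      using elim by (intro real_le_rsqrt) auto
    moreover have "2 / 3 * sqrt (real n) \<le> sqrt (2 ^ m)"
    proof (rule real_le_rsqrt)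
      have "real n \<le> 2 * 2 ^ m"
        using m(2) by (metis less_imp_le of_nat_le_iff of_nat_numeral of_nat_power power_Suc Suc_eq_plus1)
      then show "(2 / 3 * sqrt (real n))\<^sup>2 \<le> 2 ^ m"
        by (simp add: power_mult_distrib power2_eq_square)
    qed
    ultimately have "1/4 * sqrt (real n) \<le> (sqrt (2 ^ m) - 1) / 2"
      by simp
    also have "\<dots> \<le> rho_plus (l1_space n)"
      by (rule rho_plus_l1_ge_dyadic[OF m(1)])
    finally show ?case .
  qed
qed simp

end
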